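(* Let $\Delta=\{z\in\mathbb{C}:|z|<1\}$ and let $[\mu]_Z\in Z(\Delta)$. If the extremal in $[\mu]_Z$ is not unique (i.e. $[\mu]_Z$ contains more than one extremal dilatation), then $[\mu]_Z$ contains infinitely many weakly non-decreasable extremal dilatations.
   Context: $Bel(\Delta)$ is the Banach space of Beltrami differentials $\mu=\mu(z)\,d\bar z/dz$ on $\Delta$ with finite $L^\infty$-norm (i.e. complex-valued $\mu\in L^\infty(\Delta)$; elements are identified when equal a.e.). The norm is not required to be less than $1$. $Q(\Delta)$ is the Banach space of holomorphic functions (quadratic differentials) $\varphi$ on $\Delta$ with $\|\varphi\|=\iint_\Delta|\varphi(z)|\,dxdy<\infty$. Two elements $\mu,\nu\in Bel(\Delta)$ are infinitesimally Teichmüller equivalent if $\iint_\Delta(\mu-\nu)\varphi\,dxdy=0$ for all $\varphi\in Q(\Delta)$; $[\mu]_Z$ denotes the equivalence class of $\mu$, and $Z(\Delta)$ is the quotient space, with norm $\|[\mu]_Z\|=\inf\{\|\nu\|_\infty:\nu\in[\mu]_Z\}$. A Beltrami differential (also called a dilatation) $\nu\in[\mu]_Z$ is extremal if $\|\nu\|_\infty=\|[\mu]_Z\|$. A Beltrami differential $\mu$ is strongly decreasable in $[\mu]_Z$ if there exists $\nu\in[\mu]_Z$ such that (A) $|\nu(z)|\le|\mu(z)|$ for almost all $z\in\Delta$, and (B) there exist a (nonempty) domain $G\subset\Delta$ and $\delta>0$ with $|\nu(z)|\le|\mu(z)|-\delta$ for almost all $z\in G$. Otherwise $\mu$ is weakly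 non-decreasable. *)

theory Defs
  imports
    "HOL-Complex_Analysis.Complex_Analysis"
    "HOL-Probability.Essential_Supremum"
begin

abbreviation unit_disk :: "complex set"  ("\<Delta>")
  where "\<Delta> \<equiv> ball 0 1"

abbreviation disk_measure :: "complex measure"
  where "disk_measure \<equiv> lebesgue_on \<Delta>"

definition linf_norm :: "(complex \<Rightarrow> complex) \<Rightarrow> ereal"
  where "linf_norm \<mu> = esssup disk_measure (\<lambda>z. ereal (norm (\<mu> z)))"

text \<open>Beltrami differentials are represented by functions on the whole plane, whose values outside
  the disk are irrelevant; an element of the Banach space of Beltrami differentials is a class of
  \<open>bel_rel\<close>.\<close>

definition Bel :: "(complex \<Rightarrow> complex) set"
  where "Bel = {\<mu>. \<mu> \<in> borel_measurable disk_measure \<and> linf_norm \<mu> < \<infinity>}"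

definition bel_rel :: "((complex \<Rightarrow> complex) \<times> (complex \<Rightarrow> complex)) set"
  where "bel_rel = {(\<mu>, \<nu>). \<mu> \<in> Bel \<and> \<nu> \<in> Bel \<and> (AE z in disk_measure. \<mu> z = \<nu> z)}"

lemma equiv_bel_rel: "equiv Bel bel_rel"
proof (rule equivI)
  show "trans bel_rel"
    unfolding bel_rel_def by (rule transI) (auto elim: AE_mp)
qed (auto simp: bel_rel_def refl_on_def sym_def elim: AE_mp)

definition Q :: "(complex \<Rightarrow> complex) set"
  where "Q = {\<phi>. \<phi> holomorphic_on \<Delta> \<and> integrable disk_measure \<phi>}"

definition inf_teich_rel :: "((complex \<Rightarrow> complex) \<times> (complex \<Rightarrow> complex)) set"
  where "inf_teich_rel = {(\<mu>, \<nu>). \<mu> \<in> Bel \<and> \<nu> \<in> Bel \<and>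
    (\<forall>\<phi>\<in>Q. (LINT z|disk_measure. (\<mu> z - \<nu> z) * \<phi> z) = 0)}"

lemma integrable_Bel_mult_Q:
  assumes "\<mu> \<in> Bel" "\<phi> \<in> Q"
  shows "integrable disk_measure (\<lambda>z. \<mu> z * \<phi> z)"
proof -
  have m: "\<mu> \<in> borel_measurable disk_measure" and fin: "linf_norm \<mu> < \<infinity>"
    and i: "integrable disk_measure \<phi>"
    using assms by (auto simp: Bel_def Q_def)
  have *: "AE z in disk_measure. ereal (norm (\<mu> z)) \<le> linf_norm \<mu>"
    unfolding linf_norm_def by (rule esssup_AE)
  obtain r where r: "linf_norm \<mu> \<le> ereal r"
    using fin by (cases "linf_norm \<mu>") auto
  have "AE z in disk_measure. norm (\<mu> z) \<le> r"
    using * by eventually_elim (use r order_trans in fastforce)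
  then have b: "AE z in disk_measure. norm (\<mu> z * \<phi> z) \<le> norm (of_real r * \<phi> z)"
    by eventually_elim (auto simp: norm_mult intro!: mult_right_mono)
  have "integrable disk_measure (\<lambda>z. of_real r * \<phi> z)"
    using i by simp
  moreover have "(\<lambda>z. \<mu> z * \<phi> z) \<in> borel_measurable disk_measure"
    using m borel_measurable_integrable[OF i] by (rule borel_measurable_times)
  ultimately show ?thesis
    using b by (rule Bochner_Integration.integrable_bound)
qed

lemma equiv_inf_teich_rel: "equiv Bel inf_teich_rel"
proof -
  have eq: "inf_teich_rel = {(\<mu>, \<nu>). \<mu> \<in> Bel \<and> \<nu> \<in> Bel \<and>
      (\<forall>\<phi>\<in>Q. (LINT z|disk_measure. \<mu> z * \<phi> z) = (LINT z|disk_measure. \<nu> z * \<phi> z))}"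
    unfolding inf_teich_rel_def
    by (auto simp: left_diff_distrib integrable_Bel_mult_Q)
  show ?thesis
    unfolding eq by (rule equivI) (auto simp: refl_on_def sym_def trans_def)
qed

definition Z_space :: "(complex \<Rightarrow> complex) set set"
  where "Z_space = Bel // inf_teich_rel"

definition Z_norm :: "(complex \<Rightarrow> complex) set \<Rightarrow> ereal"
  where "Z_norm C = (INF \<nu>\<in>C. linf_norm \<nu>)"

definition extremal_in :: "(complex \<Rightarrow> complex) set \<Rightarrow> (complex \<Rightarrow> complex) \<Rightarrow> bool"
  where "extremal_in C \<nu> \<longleftrightarrow> \<nu> \<in> C \<and> linf_norm \<nu> = Z_norm C"

definition strongly_decreasable_in :: "(complex \<Rightarrow> complex) set \<Rightarrow> (complex \<Rightarrow> complex) \<Rightarrow> bool"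
  where "strongly_decreasable_in C \<mu> \<longleftrightarrow> (\<exists>\<nu>\<in>C.
    (AE z in disk_measure. norm (\<nu> z) \<le> norm (\<mu> z)) \<and>
    (\<exists>G \<delta>. open G \<and> connected G \<and> G \<noteq> {} \<and> G \<subseteq> \<Delta> \<and> \<delta> > 0 \<and>
       (AE z in lebesgue_on G. norm (\<nu> z) \<le> norm (\<mu> z) - \<delta>)))"

definition weakly_non_decreasable_in :: "(complex \<Rightarrow> complex) set \<Rightarrow> (complex \<Rightarrow> complex) \<Rightarrow> bool"
  where "weakly_non_decreasable_in C \<mu> \<longleftrightarrow> \<mu> \<in> C \<and> \<not> strongly_decreasable_in C \<mu>"

end

theory Submission
  imports Defs
begin

text \<open>Let \<open>k\<close> be the norm of the class. The extremal dilatations are the members of the class bounded by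
  \<open>k\<close>; they form a convex set that is complete for the \<open>L\<^sup>1\<close> distance. If an extremal \<open>g\<close> is strongly
  decreasable on a domain \<open>G\<close> by \<open>\<delta>\<close>, then \<open>\<bar>g\<bar> \<ge> \<delta>\<close> on \<open>G\<close>, and some extremal is bounded by \<open>k - \<delta>\<close> on
  \<open>G\<close>. Whenever the latter happens, every extremal can be moved slightly towards that one to gain
  room below \<open>k\<close> on \<open>G\<close>, and then be made small on a tiny disk inside \<open>G\<close>, the mass removed being
  spread over a larger disk by the Bergman kernel; so \<open>\<bar>g\<bar> \<ge> \<delta>\<close> on \<open>G\<close> defines a nowhere dense set
  of extremals. By Baire's argument the weakly non-decreasable extremals are \<open>L\<^sup>1\<close>-dense among all
  extremals, and these contain a nontrivial segment.\<close>

section \<open>Orthogonality of powers on a disk\<close>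

text \<open>The preimage of a box under \<open>g\<close> is its image under the inverse
  \<open>h\<close>, which is again orthogonal and so preserves Lebesgue measure. Values on boxes
  determine \<open>lborel\<close>.\<close>

lemma distr_lborel_orthogonal:
  fixes g :: "(real,'n::{finite,wellorder}) vec \<Rightarrow> (real,'n) vec"
  assumes g: "orthogonal_transformation g"
  shows "distr lborel borel g = lborel"
proof -
  have lin: "linear g" using g by (rule orthogonal_transformation_linear)
  have meas: "g \<in> borel_measurable borel"
    using linear_continuous_on[OF linear_conv_bounded_linear[THEN iffD1, OF lin]]
    by (rule borel_measurable_continuous_onI)
  obtain h where h: "orthogonal_transformation h" "\<And>x. h (g x) = x" "\<And>y. g (h y) = y"
    using orthogonal_transformation_inv[OF g] orthogonal_transformation_bij[OF g]
    by (metis bij_inv_eq_iff)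
  show ?thesis
  proof (rule lborel_eqI[symmetric])
    fix l u :: "(real,'n) vec"
    assume le: "\<And>b. b \<in> Basis \<Longrightarrow> l \<bullet> b \<le> u \<bullet> b"
    have eq: "g -` box l u = h ` box l u"
      using h by (auto simp: image_iff) metis
    have "g -` box l u \<in> sets borel"
      using measurable_sets[OF meas, of "box l u"] by simp
    then have s: "h ` box l u \<in> sets borel" using eq by simp
    have L: "h ` box l u \<in> lmeasurable"
      by (rule measurable_orthogonal_image[OF h(1)]) simp
    have "emeasure (distr lborel borel g) (box l u) = emeasure lborel (h ` box l u)"
      using meas by (subst emeasure_distr) (auto simp: eq)
    also have "\<dots> = emeasure lebesgue (h ` box l u)"
      using s by simp
    also have "\<dots> = ennreal (measure lebesgue (h ` box l u))"
      using L by (simp add: emeasure_eq_measure2)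
    also have "measure lebesgue (h ` box l u) = measure lebesgue (box l u)"
      by (rule measure_orthogonal_image[OF h(1)]) simp
    also have "measure lebesgue (box l u) = (\<Prod>b\<in>Basis. (u - l) \<bullet> b)"
      using le by (simp add: measure_lborel_box_eq)
    finally show "emeasure (distr lborel borel g) (box l u) = (\<Prod>b\<in>Basis. (u - l) \<bullet> b)" .
  qed simp
qed

text \<open>Both measures give a box the product of its side lengths. The identification carries
  results on orthogonal maps of \<open>real^2\<close> over to the complex plane.\<close>

lemma distr_lborel_vec_complex:
  "distr lborel borel (\<lambda>x::real^2. Complex (x$1) (x$2)) = lborel"
proof (rule lborel_eqI[symmetric])
  have [measurable]: "(\<lambda>x::real^2. Complex (x$1) (x$2)) \<in> borel_measurable borel"
    by (intro borel_measurable_continuous_onI continuous_intros)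
  fix l u :: complex
  assume le: "\<And>b. b \<in> Basis \<Longrightarrow> l \<bullet> b \<le> u \<bullet> b"
  have eq: "(\<lambda>x::real^2. Complex (x$1) (x$2)) -` box l u = box (vector [Re l, Im l]) (vector [Re u, Im u])"
    by (auto simp: box_def Basis_complex_def Basis_vec_def inner_axis exhaust_2 UNIV_2)
  have "emeasure lborel (box (vector [Re l, Im l]) (vector [Re u, Im u]) :: (real^2) set) = (\<Prod>b\<in>Basis. (u - l) \<bullet> b)"
    using le[of 1] le[of \<i>] by (simp add: emeasure_lborel_box_eq Basis_vec_def inner_axis UNIV_2 Basis_complex_def axis_eq_axis
      insert_commute)
  then show "emeasure (distr lborel borel (\<lambda>x::real^2. Complex (x$1) (x$2))) (box l u) = (\<Prod>b\<in>Basis. (u - l) \<bullet> b)"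
    by (subst emeasure_distr) (auto simp: eq)
qed simp

text \<open>In the real coordinates given by \<open>T\<close>, multiplication by \<open>u\<close>
  becomes the linear map \<open>g\<close>. It is orthogonal because \<open>T\<close> preserves norms
  and \<open>u\<close> is unimodular, so the invariance on \<open>real^2\<close> can be pushed
  forward through \<open>T\<close>.\<close>

lemma distr_lborel_rotation:
  fixes u :: complex
  assumes u: "norm u = 1"
  shows "distr lborel borel ((*) u) = lborel"
proof -
  define T where "T = (\<lambda>x::real^2. Complex (x$1) (x$2))"
  define g :: "real^2 \<Rightarrow> real^2" where "g = (\<lambda>x. vector [Re (u * T x), Im (u * T x)])"
  have [measurable]: "T \<in> borel_measurable borel"
    unfolding T_def by (intro borel_measurable_continuous_onI continuous_intros)
  have T: "distr lborel borel T = lborel"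
    unfolding T_def by (rule distr_lborel_vec_complex)
  have Tg: "T (g x) = u * T x" for x
    by (simp add: T_def g_def complex_eq_iff)
  have nT: "norm (T x) = norm x" for x
    by (simp add: T_def norm_vec_def L2_set_def UNIV_2 cmod_def)
  have lin: "linear g"
    by (rule linearI) (simp_all add: g_def T_def vec_eq_iff forall_2 algebra_simps)
  have og: "orthogonal_transformation g"
    unfolding orthogonal_transformation using lin
    by (auto simp flip: nT simp: Tg norm_mult u)
  have [measurable]: "g \<in> borel_measurable borel"
    using linear_continuous_on[OF linear_conv_bounded_linear[THEN iffD1, OF lin]]
    by (rule borel_measurable_continuous_onI)
  have "distr lborel borel ((*) u) = distr (distr lborel borel T) borel ((*) u)"
    by (simp add: T)
  also have "\<dots> = distr lborel borel (T \<circ> g)"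
    by (subst distr_distr) (auto simp: Tg comp_def)
  also have "\<dots> = distr (distr lborel borel g) borel T"
    by (subst distr_distr) auto
  also have "\<dots> = lborel"
    by (simp add: distr_lborel_orthogonal[OF og] T)
  finally show ?thesis .
qed

text \<open>A suitable rotation about the centre multiplies the integrand by -1 and preserves both
  disk and measure, so the integral equals its own negative. This is done at the origin and then
  translated to \<open>p\<close>.\<close>

lemma integral_ball_power_cnj_power_eq_0:
  fixes p :: complex
  assumes "m \<noteq> n"
  shows "(LINT z|lborel. indicator (ball p R) z * ((z - p) ^ m * cnj (z - p) ^ n)) = 0"
proof -
  define f where "f = (\<lambda>z::complex. indicator (ball 0 R) z * (z ^ m * cnj z ^ n))"
  have [measurable]: "f \<in> borel_measurable borel"
    unfolding f_def
    by (intro borel_measurable_times borel_measurable_indicator borel_measurable_continuous_onI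
        continuous_intros) auto
  \<comment> \<open>The angle is chosen so that \<open>m - n\<close> times it equals pi; the
    difference is taken in the reals and may be negative.\<close>
  define u where "u = cis (pi / (real m - real n))"
  have ne: "real m - real n \<noteq> 0" using assms by simp
  have "u ^ m * cnj u ^ n = cis (real m * (pi / (real m - real n)) - real n * (pi / (real m - real n)))"
    unfolding u_def by (simp add: Complex.DeMoivre cis_cnj cis_mult)
  also have "real m * (pi / (real m - real n)) - real n * (pi / (real m - real n)) = pi"
    using ne by (metis left_diff_distrib nonzero_mult_div_cancel_left times_divide_eq_right)
  finally have um: "u ^ m * cnj u ^ n = -1" by simp
  have nu: "norm u = 1" by (simp add: u_def)
  have fu: "f (u * z) = - f z" for z
  proof -
    have "(u * z) ^ m * cnj (u * z) ^ n = (u ^ m * cnj u ^ n) * (z ^ m * cnj z ^ n)"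
      by (simp add: power_mult_distrib)
    then show ?thesis by (simp add: f_def um nu norm_mult indicator_def)
  qed
  have "(LINT z|lborel. f z) = (LINT z|distr lborel borel ((*) u). f z)"
    by (simp add: distr_lborel_rotation nu)
  also have "\<dots> = (LINT z|lborel. f (u * z))"
    by (rule integral_distr) auto
  also have "\<dots> = - (LINT z|lborel. f z)" by (simp add: fu)
  finally have 0: "(LINT z|lborel. f z) = 0" by simp
  have "(LINT z|lborel. f z) = (LINT z|distr lborel borel ((+) (-p)). f z)"
    by (simp add: lborel_distr_plus)
  also have "\<dots> = (LINT z|lborel. f (-p + z))"
    by (rule integral_distr) auto
  also have "\<dots> = (LINT z|lborel. indicator (ball p R) z * ((z - p) ^ m * cnj (z - p) ^ n))"
    by (intro Bochner_Integration.integral_cong) (auto simp: f_def indicator_def dist_norm norm_minus_commute)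
  finally show ?thesis using 0 by simp
qed

section \<open>Concentrated mass spread over a larger disk\<close>

lemma finite_measure_disk: "finite_measure disk_measure"
  by (rule finite_measure_lebesgue_on) simp

lemma integrable_disk_bounded:
  fixes f :: "complex \<Rightarrow> 'a::{banach, second_countable_topology}"
  assumes "f \<in> borel_measurable disk_measure" "AE z in disk_measure. norm (f z) \<le> B"
  shows "integrable disk_measure f"
  using finite_measure.integrable_const_bound[OF finite_measure_disk] assms by blast

lemma indicator_disk_measurable [measurable]:
  "(indicator (ball p r) :: complex \<Rightarrow> complex) \<in> borel_measurable disk_measure"
  by (rule measurable_restrict_space1[OF borel_measurable_indicator]) simp

lemma continuous_disk_measurable:
  fixes f :: "complex \<Rightarrow> complex"
  assumes "continuous_on UNIV f"
  shows "f \<in> borel_measurable disk_measure"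
  by (rule measurable_restrict_space1, rule measurable_completion)
    (simp add: borel_measurable_continuous_onI[OF assms])

text \<open>Rotation invariance is available for \<open>lborel\<close>, while pairings with
  \<open>Q\<close> are integrals over the restricted completed measure. Extension by zero and
  completion do not change the value, which links the two.\<close>

lemma integral_disk_eq_lborel:
  fixes h :: "complex \<Rightarrow> complex"
  assumes "ball p r \<subseteq> \<Delta>" "continuous_on UNIV h"
  shows "(LINT z|disk_measure. indicator (ball p r) z * h z) = (LINT z|lborel. indicator (ball p r) z * h z)"
proof -
  have "(\<lambda>z. indicator (ball p r) z * h z) \<in> borel_measurable lborel"
    using borel_measurable_continuous_onI[OF assms(2)] by (intro borel_measurable_times borel_measurable_indicator) auto
  then have "(LINT z|lborel. indicator (ball p r) z * h z) = (LINT z|lebesgue. indicator (ball p r) z * h z)"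
    by (rule integral_completion[symmetric])
  also have "\<dots> = (LINT z|lebesgue. indicator \<Delta> z *\<^sub>R (indicator (ball p r) z * h z))"
    using assms(1) by (intro Bochner_Integration.integral_cong) (auto simp: indicator_def)
  also have "\<dots> = (LINT z|disk_measure. indicator (ball p r) z * h z)"
    by (rule integral_restrict_space[symmetric]) simp
  finally show ?thesis ..
qed

text \<open>The closed disk lies compactly inside \<open>\<Delta>\<close>, so the Taylor series of
  \<open>\<phi>\<close> at \<open>p\<close> converges on a strictly larger disk. Hence
  \<open>norm (a n) * R ^ n\<close> is summable and dominates the terms uniformly, which permits
  integration term by term.\<close>

lemma taylor_under_integral:
  assumes hol: "\<phi> holomorphic_on \<Delta>" and sub: "cball p R \<subseteq> \<Delta>" and R: "0 < R" and r: "r \<le> R"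
    and g: "g \<in> borel_measurable disk_measure" and gk: "AE z in disk_measure. norm (g z) \<le> k"
  shows "(\<lambda>n. (deriv ^^ n) \<phi> p / fact n * (LINT z|disk_measure. indicator (ball p r) z * (g z * (z - p) ^ n)))
    sums (LINT z|disk_measure. indicator (ball p r) z * (g z * \<phi> z))"
proof -
  define a where "a n = (deriv ^^ n) \<phi> p / fact n" for n
  \<comment> \<open>This is the gap between the closed disk and the unit circle. Half of it gives a
    radius \<open>s\<close> beyond \<open>R\<close> at which the series still converges, so that it
    converges absolutely at radius \<open>R\<close>.\<close>
  define e where "e = 1 - R - norm p"
  have e: "e > 0"
    using sub R by (simp add: e_def cball_subset_ball_iff)
  have bsub: "ball p (R + e) \<subseteq> \<Delta>"
    using R e by (simp add: ball_subset_ball_iff e_def)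
  have ps: "(\<lambda>n. a n * (w - p) ^ n) sums \<phi> w" if "w \<in> ball p (R + e)" for w
    unfolding a_def using that
    by (intro holomorphic_power_series[of _ p "R + e"] holomorphic_on_subset[OF hol bsub]) auto
  define s where "s = R + e / 2"
  have s: "R < s" "s < R + e" using e by (auto simp: s_def)
  have "summable (\<lambda>n. a n * of_real s ^ n)"
    using ps[of "p + of_real s"] s R by (auto simp: dist_norm sums_iff)
  then have "summable (\<lambda>n. norm (a n * of_real R ^ n))"
    by (rule powser_insidea) (use s R in auto)
  then have sm: "summable (\<lambda>n. norm (a n) * R ^ n)"
    using R by (simp add: norm_mult norm_power)
  define f where "f n z = indicator (ball p r) z * (g z * (a n * (z - p) ^ n))" for n z
  have bd: "AE z in disk_measure. \<forall>n. norm (f n z) \<le> \<bar>k\<bar> * (norm (a n) * R ^ n)"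
    using gk
  proof eventually_elim
    case (elim z)
    show ?case
    proof
      fix n
      show "norm (f n z) \<le> \<bar>k\<bar> * (norm (a n) * R ^ n)"
      proof (cases "z \<in> ball p r")
        case True
        then have "norm (z - p) \<le> R" using r by (simp add: dist_norm norm_minus_commute)
        then have "norm (z - p) ^ n \<le> R ^ n" by (intro power_mono) auto
        then have "norm (g z) * (norm (a n) * norm (z - p) ^ n) \<le> \<bar>k\<bar> * (norm (a n) * R ^ n)"
          using elim by (intro mult_mono) auto
        then show ?thesis using True by (simp add: f_def norm_mult norm_power)
      qed (use R in \<open>simp add: f_def\<close>)
    qed
  qed
  have fm [measurable]: "f n \<in> borel_measurable disk_measure" for n
    unfolding f_def
    by (intro borel_measurable_times g indicator_disk_measurable continuous_disk_measurable continuous_intros)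
  have fi: "integrable disk_measure (f n)" for n
    using bd by (intro integrable_disk_bounded[where B = "\<bar>k\<bar> * (norm (a n) * R ^ n)"]) auto
  have "(\<lambda>n. integral\<^sup>L disk_measure (f n)) sums (LINT z|disk_measure. (\<Sum>n. f n z))"
  proof (rule sums_integral[OF fi])
    show "AE z in disk_measure. summable (\<lambda>n. norm (f n z))"
      using bd
    proof eventually_elim
      case (elim z)
      then show ?case
        by (intro summable_comparison_test'[OF summable_mult[OF sm, of "\<bar>k\<bar>"]]) auto
    qed
    show "summable (\<lambda>n. LINT z|disk_measure. norm (f n z))"
    proof (rule summable_comparison_test'[OF summable_mult[OF sm, of "\<bar>k\<bar> * measure disk_measure \<Delta>"]])
      fix n :: nat
      have "(LINT z|disk_measure. norm (f n z)) \<le> (LINT z|disk_measure. \<bar>k\<bar> * (norm (a n) * R ^ n))"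
        using bd by (intro integral_mono_AE integrable_norm fi finite_measure.integrable_const[OF finite_measure_disk]) auto
      then show "norm (LINT z|disk_measure. norm (f n z)) \<le> \<bar>k\<bar> * measure disk_measure \<Delta> * (norm (a n) * R ^ n)"
        by (simp add: mult_ac space_restrict_space)
    qed
  qed
  moreover have "integral\<^sup>L disk_measure (f n) = a n * (LINT z|disk_measure. indicator (ball p r) z * (g z * (z - p) ^ n))" for n
  proof -
    have "f n = (\<lambda>z. a n * (indicator (ball p r) z * (g z * (z - p) ^ n)))"
      by (simp add: f_def fun_eq_iff mult_ac)
    then show ?thesis by simp
  qed
  moreover have "(\<Sum>n. f n z) = indicator (ball p r) z * (g z * \<phi> z)" for z
  proof (cases "z \<in> ball p r")
    case True
    then have "(\<lambda>n. a n * (z - p) ^ n) sums \<phi> z" using r e by (intro ps) auto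
    then have "(\<lambda>n. g z * (a n * (z - p) ^ n)) sums (g z * \<phi> z)" by (rule sums_mult)
    then show ?thesis using True by (simp add: f_def sums_iff)
  qed (simp add: f_def)
  ultimately show ?thesis unfolding a_def by simp
qed

lemma sup_small_representative_on_ball:
  assumes sub: "cball p R \<subseteq> \<Delta>" and R: "0 < R"
    and f: "f \<in> borel_measurable disk_measure" and fk: "AE z in disk_measure. norm (f z) \<le> k"
    and \<epsilon>: "0 < \<epsilon>"
  obtains r \<zeta> where "0 < r" "r < R" "measure disk_measure (ball p r) \<le> \<epsilon>" "\<zeta> \<in> borel_measurable disk_measure"
    "\<forall>z. norm (\<zeta> z) \<le> \<epsilon>" "\<forall>z. z \<notin> ball p R \<longrightarrow> \<zeta> z = 0"
    "\<forall>\<phi>\<in>Q. (LINT z|disk_measure. indicator (ball p r) z * (f z * \<phi> z)) =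
      (LINT z|disk_measure. \<zeta> z * \<phi> z)"
proof -
  \<comment> \<open>\<open>\<zeta>\<close> represents the functional through the Bergman kernel: with \<open>c n\<close> the moments of \<open>f\<close> over
    the small disk and \<open>\<kappa> n\<close> the squared norm of \<open>(z - p) ^ n\<close> over the large one, it is the series
    of the terms \<open>c n / \<kappa> n * cnj (z - p) ^ n\<close>, of size \<open>O(r\<^sup>2)\<close>.\<close>
  define K where "K = \<bar>k\<bar> + 1"
  have K: "K > 0" and fK: "AE z in disk_measure. norm (f z) \<le> K"
    using fk by (auto simp: K_def elim!: eventually_mono)
  \<comment> \<open>The bound \<open>R / 8\<close> makes the series for \<open>\<zeta>\<close>
    geometric with ratio at most 1/2. The bound \<open>\<epsilon> * R / (3 * K)\<close> brings its
    sum below \<open>\<epsilon>\<close>. The bound \<open>\<epsilon> / 4\<close>, together with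
    \<open>r \<le> 1\<close> and pi below 4, controls the area of the small disk.\<close>
  define r where "r = Min {R / 8, \<epsilon> / 4, \<epsilon> * R / (3 * K)}"
  have r: "0 < r" "r \<le> R / 8" "r \<le> \<epsilon> / 4" "r \<le> \<epsilon> * R / (3 * K)"
    using R \<epsilon> K by (auto simp: r_def)
  define c where "c n = (LINT z|disk_measure. indicator (ball p r) z * (f z * (z - p) ^ n))" for n
  define \<kappa> where "\<kappa> n = (LINT z|disk_measure. indicator (ball p R) z * norm (z - p) ^ (2 * n))" for n
  define v where "v = measure disk_measure (ball p r)"
  define w where "w = measure disk_measure (ball p R - ball p (R / 2))"
  have sets_ball: "ball p s \<in> sets disk_measure" if "s \<le> R" for s
    using that sub by (auto simp: sets_restrict_space_iff subset_eq)
  have mball: "measure disk_measure (ball p s) = pi * s ^ 2" if "s \<le> R" "0 \<le> s" for s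
  proof -
    have "measure disk_measure (ball p s) = measure lebesgue (ball p s)"
      using that sub by (intro measure_restrict_space) (auto simp: subset_eq)
    also have "\<dots> = pi * s ^ 2"
      using content_ball[OF that(2), of p] by (simp add: unit_ball_vol_2 eval_unit_ball_vol)
    finally show ?thesis .
  qed
  have v: "v = pi * r ^ 2" unfolding v_def using r R by (intro mball) auto
  have w: "w = pi * (3 / 4 * R ^ 2)"
  proof -
    have "w = measure disk_measure (ball p R) - measure disk_measure (ball p (R / 2))"
      unfolding w_def using R
      by (intro finite_measure.finite_measure_Diff[OF finite_measure_disk] sets_ball) auto
    then show ?thesis using R by (simp add: mball power2_eq_square field_simps)
  qed
  have wpos: "w > 0" using R by (simp add: w)
  have indi: "integrable disk_measure (\<lambda>z. indicator (ball p s) z * b)" if "s \<le> R" for s and b :: real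
    using sets_ball[OF that] by (intro integrable_mult_left integrable_real_indicator)
      (auto simp: finite_measure.emeasure_eq_measure[OF finite_measure_disk])
  have cb: "norm (c n) \<le> K * v * r ^ n" for n
  proof -
    define h where "h z = indicator (ball p r) z * (f z * (z - p) ^ n)" for z
    have hb: "AE z in disk_measure. norm (h z) \<le> indicator (ball p r) z * (K * r ^ n)"
      using fK
    proof eventually_elim
      case (elim z)
      then show ?case using K
        by (auto simp: h_def indicator_def norm_mult norm_power dist_norm norm_minus_commute intro!: mult_mono power_mono)
    qed
    have hm: "h \<in> borel_measurable disk_measure"
      unfolding h_def
      by (intro borel_measurable_times f indicator_disk_measurable continuous_disk_measurable continuous_intros)
    have hi: "integrable disk_measure h"
    proof (rule integrable_disk_bounded[OF hm, where B = "K * r ^ n"])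
      show "AE z in disk_measure. norm (h z) \<le> K * r ^ n"
        using hb
      proof eventually_elim
        case (elim z)
        have "indicator (ball p r) z * (K * r ^ n) \<le> K * r ^ n"
          using K r by (simp add: indicator_def)
        then show ?case using elim by linarith
      qed
    qed
    have "norm (c n) \<le> (LINT z|disk_measure. norm (h z))"
      unfolding c_def h_def by (rule integral_norm_bound)
    also have "\<dots> \<le> (LINT z|disk_measure. indicator (ball p r) z * (K * r ^ n))"
      using hb by (intro integral_mono_AE integrable_norm hi indi) (use r R in auto)
    also have "\<dots> = K * v * r ^ n"
    proof -
      have "ball p r \<inter> \<Delta> = ball p r" using r R sub by (auto simp: subset_eq)
      then show ?thesis using r R sets_ball[of r] by (simp add: v_def)
    qed
    finally show ?thesis .
  qed
  \<comment> \<open>Only the outer annulus, of area \<open>w\<close>, is kept: there the distance to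
    \<open>p\<close> is at least \<open>R / 2\<close>.\<close>
  have \<kappa>b: "(R / 2) ^ (2 * n) * w \<le> \<kappa> n" for n
  proof -
    have S: "ball p R - ball p (R / 2) \<in> sets disk_measure"
      using R by (intro sets.Diff sets_ball) auto
    have "(R / 2) ^ (2 * n) * w = (LINT z|disk_measure. indicator (ball p R - ball p (R / 2)) z * (R / 2) ^ (2 * n))"
    proof -
      have "(ball p R - ball p (R / 2)) \<inter> \<Delta> = ball p R - ball p (R / 2)" using sub by (auto simp: subset_eq)
      then show ?thesis using S by (simp add: w_def)
    qed
    also have "\<dots> \<le> \<kappa> n"
      unfolding \<kappa>_def
    proof (rule integral_mono)
      show "integrable disk_measure (\<lambda>z. indicator (ball p R - ball p (R / 2)) z * (R / 2) ^ (2 * n))"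
        using S by (intro integrable_mult_left integrable_real_indicator)
          (auto simp: finite_measure.emeasure_eq_measure[OF finite_measure_disk])
      show "integrable disk_measure (\<lambda>z. indicator (ball p R) z * norm (z - p) ^ (2 * n))"
      proof (rule integrable_disk_bounded[where B = "R ^ (2 * n)"])
        have "(\<lambda>z. z - p) \<in> borel_measurable disk_measure"
          by (intro continuous_disk_measurable continuous_intros)
        then show "(\<lambda>z. indicator (ball p R) z * norm (z - p) ^ (2 * n)) \<in> borel_measurable disk_measure"
          using sets_ball[of R] by (intro borel_measurable_times borel_measurable_power borel_measurable_norm) auto
        show "AE z in disk_measure. norm (indicator (ball p R) z * norm (z - p) ^ (2 * n)) \<le> R ^ (2 * n)"
          using R by (intro AE_I2) (auto simp: indicator_def dist_norm norm_minus_commute intro!: power_mono)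
      qed
      show "indicator (ball p R - ball p (R / 2)) z * (R / 2) ^ (2 * n) \<le> indicator (ball p R) z * norm (z - p) ^ (2 * n)" for z
        using R by (auto simp: indicator_def dist_norm norm_minus_commute intro!: power_mono)
    qed
    finally show ?thesis .
  qed
  have \<kappa>0: "\<kappa> n > 0" for n
    using \<kappa>b[of n] wpos R by (metis less_le_trans mult_pos_pos zero_less_power half_gt_zero)
  define C where "C = K * v / w"
  have C: "0 \<le> C" "2 * C \<le> \<epsilon>"
  proof -
    show "0 \<le> C" using K wpos by (simp add: C_def v)
    have "2 * C = (8 / 3) * K * r ^ 2 / R ^ 2"
      using R by (simp add: C_def v w field_simps)
    also have "\<dots> = (8 / 3) * K * (r / R) * (r / R)" by (simp add: power2_eq_square)
    also have "\<dots> \<le> (8 / 3) * K * (\<epsilon> / (3 * K)) * 1"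
      using r R K \<epsilon> by (intro mult_mono) (auto simp: field_simps)
    also have "\<dots> \<le> \<epsilon>" using K \<epsilon> by simp
    finally show "2 * C \<le> \<epsilon>" .
  qed
  define t where "t n z = indicator (ball p R) z * (c n / of_real (\<kappa> n) * cnj (z - p) ^ n)" for n z
  \<comment> \<open>The decay \<open>r ^ n\<close> of the moments is set against the lower bound for
    \<open>\<kappa> n\<close> and the growth \<open>R ^ n\<close> of the conjugate power. What
    remains is the ratio \<open>4 * r / R\<close>, at most 1/2.\<close>
  have tb: "norm (t n z) \<le> C * (1 / 2) ^ n" for n z
  proof (cases "z \<in> ball p R")
    case True
    have "norm (t n z) = norm (c n) / \<kappa> n * norm (z - p) ^ n"
      using True \<kappa>0[of n] by (simp add: t_def norm_mult norm_divide norm_power flip: complex_cnj_diff)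
    also have "\<dots> \<le> (K * v * r ^ n) / ((R / 2) ^ (2 * n) * w) * R ^ n"
      using True \<kappa>b[of n] cb[of n] R wpos K r
      by (intro mult_mono frac_le power_mono) (auto simp: v dist_norm norm_minus_commute)
    also have "\<dots> = C * (r * R / (R / 2)\<^sup>2) ^ n"
      by (simp only: C_def power_divide[of "r * R"] power_mult_distrib power_mult) (simp add: mult_ac)
    also have "\<dots> = C * (4 * r / R) ^ n"
      using R by (simp add: power2_eq_square mult.commute)
    also have "\<dots> \<le> C * (1 / 2) ^ n"
      using C r R by (intro mult_left_mono power_mono) (auto simp: field_simps)
    finally show ?thesis .
  qed (use C in \<open>simp add: t_def\<close>)
  have geo: "summable (\<lambda>n. C * (1 / 2) ^ n)" "(\<Sum>n. C * (1 / 2) ^ n) = 2 * C"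
    using suminf_geometric[of "1/2::real"] by (auto simp: suminf_mult summable_geometric)
  have tn: "summable (\<lambda>n. norm (t n z))" for z
    by (rule summable_comparison_test'[OF geo(1)]) (use tb in auto)
  define \<zeta> where "\<zeta> z = (\<Sum>n. t n z)" for z
  have tm [measurable]: "t n \<in> borel_measurable disk_measure" for n
    unfolding t_def
    by (intro borel_measurable_times indicator_disk_measurable continuous_disk_measurable continuous_intros)
  have \<zeta>m: "\<zeta> \<in> borel_measurable disk_measure"
    unfolding \<zeta>_def by measurable
  have \<zeta>b: "norm (\<zeta> z) \<le> \<epsilon>" for z
  proof -
    have "norm (\<zeta> z) \<le> (\<Sum>n. norm (t n z))"
      unfolding \<zeta>_def by (rule summable_norm[OF tn])
    also have "\<dots> \<le> (\<Sum>n. C * (1 / 2) ^ n)"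
      by (intro suminf_le tb tn geo)
    finally show ?thesis using C geo by simp
  qed
  have \<zeta>0: "\<zeta> z = 0" if "z \<notin> ball p R" for z
    using that by (simp add: \<zeta>_def t_def)
  have eq: "(LINT z|disk_measure. indicator (ball p r) z * (f z * \<phi> z)) = (LINT z|disk_measure. \<zeta> z * \<phi> z)"
    if "\<phi> \<in> Q" for \<phi>
  proof -
    have hol: "\<phi> holomorphic_on \<Delta>" and int: "integrable disk_measure \<phi>"
      using that by (auto simp: Q_def)
    have pm [measurable]: "\<phi> \<in> borel_measurable disk_measure"
      using int by simp
    define a where "a n = (deriv ^^ n) \<phi> p / fact n" for n
    have 1: "(\<lambda>n. a n * c n) sums (LINT z|disk_measure. indicator (ball p r) z * (f z * \<phi> z))"
      unfolding a_def c_def using r R by (intro taylor_under_integral[OF hol sub R _ f fk]) auto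
    have inb: "integrable disk_measure (\<lambda>z. t n z * \<phi> z)" for n
    proof (rule Bochner_Integration.integrable_bound)
      show "integrable disk_measure (\<lambda>z. of_real (C * (1 / 2) ^ n) * \<phi> z)" using int by simp
      show "AE z in disk_measure. norm (t n z * \<phi> z) \<le> norm (of_real (C * (1 / 2) ^ n) * \<phi> z)"
        using tb[of n] C by (auto simp: norm_mult norm_power norm_divide intro!: mult_right_mono)
    qed measurable
    have 2: "(\<lambda>n. LINT z|disk_measure. t n z * \<phi> z) sums (LINT z|disk_measure. (\<Sum>n. t n z * \<phi> z))"
    proof (rule sums_integral[OF inb])
      show "AE z in disk_measure. summable (\<lambda>n. norm (t n z * \<phi> z))"
        using tn by (auto simp: norm_mult intro!: summable_mult2)
      show "summable (\<lambda>n. LINT z|disk_measure. norm (t n z * \<phi> z))"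
      proof (rule summable_comparison_test'[OF summable_mult2[OF geo(1), of "LINT z|disk_measure. norm (\<phi> z)"]])
        fix n :: nat
        have "(LINT z|disk_measure. norm (t n z * \<phi> z)) \<le> (LINT z|disk_measure. C * (1 / 2) ^ n * norm (\<phi> z))"
          using tb[of n] int integrable_norm[OF inb[of n]]
          by (intro integral_mono) (auto simp: norm_mult intro!: mult_right_mono)
        then show "norm (LINT z|disk_measure. norm (t n z * \<phi> z)) \<le> C * (1 / 2) ^ n * (LINT z|disk_measure. norm (\<phi> z))"
          by simp
      qed
    qed
    \<comment> \<open>With the conjugate power in the role of \<open>g\<close> on the large disk,
      the termwise expansion applies once more. Orthogonality removes every Taylor term except the
      one of index \<open>n\<close>, whose integral \<open>\<kappa> n\<close> cancels the
      normalisation in \<open>t n\<close>.\<close>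
    have 3: "(LINT z|disk_measure. t n z * \<phi> z) = a n * c n" for n
    proof -
      define g where "g = (\<lambda>z. cnj (z - p) ^ n)"
      have gm: "g \<in> borel_measurable disk_measure"
        unfolding g_def by (intro continuous_disk_measurable continuous_intros)
      have gb: "AE z in disk_measure. norm (g z) \<le> (1 + norm p) ^ n"
      proof (rule AE_I2)
        fix z assume "z \<in> space disk_measure"
        then have "norm z < 1" by (simp add: space_restrict_space)
        then have "norm (z - p) \<le> 1 + norm p" using norm_triangle_ineq4[of z p] by linarith
        then show "norm (g z) \<le> (1 + norm p) ^ n"
          by (simp add: g_def norm_power power_mono flip: complex_cnj_diff)
      qed
      have "(\<lambda>m. a m * (LINT z|disk_measure. indicator (ball p R) z * (g z * (z - p) ^ m)))
        sums (LINT z|disk_measure. indicator (ball p R) z * (g z * \<phi> z))"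
        unfolding a_def by (rule taylor_under_integral[OF hol sub R order_refl gm gb])
      moreover have "(LINT z|disk_measure. indicator (ball p R) z * (g z * (z - p) ^ m)) = (if m = n then of_real (\<kappa> n) else 0)" for m
      proof (cases "m = n")
        case True
        have "indicator (ball p R) z * (g z * (z - p) ^ n) = of_real (indicator (ball p R) z * norm (z - p) ^ (2 * n))" for z
        proof -
          have "complex_of_real (norm (z - p) ^ (2 * n)) = of_real ((norm (z - p))\<^sup>2) ^ n"
            by (simp add: power_mult)
          also have "\<dots> = cnj (z - p) ^ n * (z - p) ^ n"
            by (simp only: complex_norm_square power_mult_distrib mult.commute)
          finally show ?thesis by (simp add: g_def indicator_def)
        qed
        then show ?thesis unfolding True \<kappa>_def by (simp only: integral_complex_of_real simp_thms if_True)
      next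
        case False
        have "(LINT z|disk_measure. indicator (ball p R) z * (g z * (z - p) ^ m)) =
          (LINT z|lborel. indicator (ball p R) z * (g z * (z - p) ^ m))"
          unfolding g_def using sub by (intro integral_disk_eq_lborel continuous_intros) auto
        also have "\<dots> = 0"
          using integral_ball_power_cnj_power_eq_0[OF False, of p R] by (simp add: g_def mult.commute)
        finally show ?thesis using False by simp
      qed
      ultimately have "(\<lambda>m. a m * (if m = n then of_real (\<kappa> n) else 0))
        sums (LINT z|disk_measure. indicator (ball p R) z * (g z * \<phi> z))"
        by simp
      moreover have "(\<lambda>m. a m * (if m = n then of_real (\<kappa> n) else 0)) sums (a n * of_real (\<kappa> n))"
        using sums_single[of n "\<lambda>m. a m * of_real (\<kappa> n)"] by (simp add: if_distrib cong: if_cong)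
      ultimately have g\<phi>: "(LINT z|disk_measure. indicator (ball p R) z * (g z * \<phi> z)) = a n * of_real (\<kappa> n)"
        by (rule sums_unique2)
      have "(\<lambda>z. t n z * \<phi> z) = (\<lambda>z. c n / of_real (\<kappa> n) * (indicator (ball p R) z * (g z * \<phi> z)))"
        by (simp add: t_def g_def fun_eq_iff)
      then have "(LINT z|disk_measure. t n z * \<phi> z) = c n / of_real (\<kappa> n) * (a n * of_real (\<kappa> n))"
        by (simp add: g\<phi>)
      then show ?thesis using \<kappa>0[of n] by simp
    qed
    have 4: "(\<Sum>n. t n z * \<phi> z) = \<zeta> z * \<phi> z" for z
      unfolding \<zeta>_def by (rule suminf_mult2[symmetric]) (rule summable_norm_cancel[OF tn])
    show ?thesis
      using sums_unique2[OF 1] 2 by (simp add: 3 4)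
  qed
  have "dist p 0 + R < 1"
    using sub R by (simp add: cball_subset_ball_iff)
  then have "r \<le> 1" using r R zero_le_dist[of p 0] by linarith
  then have "pi * r * r \<le> 4 * (\<epsilon> / 4) * 1"
    using r \<epsilon> pi_less_4 by (intro mult_mono) auto
  then have v\<epsilon>: "measure disk_measure (ball p r) \<le> \<epsilon>"
    using v by (simp add: v_def power2_eq_square)
  show thesis
    using that[OF r(1) _ v\<epsilon> \<zeta>m] r R \<zeta>b \<zeta>0 eq by force
qed

section \<open>The bounded part of a class as a complete space\<close>

text \<open>With \<open>k\<close> the norm of the class this is the set of its extremals; the bound
  is kept as a free real parameter, so that the topology can be developed without essential
  suprema.\<close>

definition class_ball :: "(complex \<Rightarrow> complex) set \<Rightarrow> real \<Rightarrow> (complex \<Rightarrow> complex) set"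
  where "class_ball C k = {f \<in> C. AE z in disk_measure. norm (f z) \<le> k}"

text \<open>The \<open>L1\<close> distance replaces the sup norm because erasing a bounded function
  on a tiny disk is then a small change. On functions it is only a pseudometric, vanishing for a.e.
  equality.\<close>

definition l1_dist :: "(complex \<Rightarrow> complex) \<Rightarrow> (complex \<Rightarrow> complex) \<Rightarrow> real"
  where "l1_dist f g = (LINT z|disk_measure. norm (f z - g z))"

lemma BelI:
  assumes "f \<in> borel_measurable disk_measure" "AE z in disk_measure. norm (f z) \<le> k"
  shows "f \<in> Bel" "linf_norm f \<le> ereal k"
proof -
  show le: "linf_norm f \<le> ereal k"
    unfolding linf_norm_def using assms by (intro esssup_I) auto
  show "f \<in> Bel"
    using assms(1) le_less_trans[OF le, of "\<infinity>"] by (simp add: Bel_def)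
qed

lemma Z_space_class:
  assumes "C \<in> Z_space" "f \<in> C"
  shows "g \<in> C \<longleftrightarrow> g \<in> Bel \<and> (\<forall>\<phi>\<in>Q. (LINT z|disk_measure. g z * \<phi> z) = (LINT z|disk_measure. f z * \<phi> z))"
proof -
  obtain a where a: "C = inf_teich_rel `` {a}"
    using assms(1) unfolding Z_space_def by (rule quotientE)
  then have af: "(a, f) \<in> inf_teich_rel" using assms(2) by simp
  then have fB: "f \<in> Bel" by (simp add: inf_teich_rel_def)
  have "C = inf_teich_rel `` {f}"
    using equiv_class_eq[OF equiv_inf_teich_rel af] a by simp
  then have "g \<in> C \<longleftrightarrow> (f, g) \<in> inf_teich_rel" by simp
  also have "\<dots> \<longleftrightarrow> g \<in> Bel \<and> (\<forall>\<phi>\<in>Q. (LINT z|disk_measure. g z * \<phi> z) = (LINT z|disk_measure. f z * \<phi> z))"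
    using fB by (auto simp: inf_teich_rel_def left_diff_distrib integrable_Bel_mult_Q)
  finally show ?thesis .
qed

lemma class_ball_AE:
  "f \<in> class_ball C k \<Longrightarrow> AE z in disk_measure. norm (f z) \<le> k"
  by (simp add: class_ball_def)

lemma class_ball_Bel:
  assumes C: "C \<in> Z_space" and f: "f \<in> class_ball C k"
  shows "f \<in> Bel"
proof -
  have "f \<in> C" using f by (simp add: class_ball_def)
  from iffD1[OF Z_space_class[OF C this] this] show ?thesis ..
qed

lemma class_ball_measurable:
  assumes "C \<in> Z_space" "f \<in> class_ball C k"
  shows "f \<in> borel_measurable disk_measure"
  using class_ball_Bel[OF assms] by (simp add: Bel_def)

text \<open>The a.e. bound already supplies membership in \<open>Bel\<close>, so a constructed
  function can be checked against a single known member by its measurability, its bound and its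
  pairings with \<open>Q\<close>.\<close>

lemma class_ball_iff:
  assumes C: "C \<in> Z_space" and f: "f \<in> class_ball C k"
  shows "g \<in> class_ball C k \<longleftrightarrow> g \<in> borel_measurable disk_measure \<and> (AE z in disk_measure. norm (g z) \<le> k) \<and>
    (\<forall>\<phi>\<in>Q. (LINT z|disk_measure. g z * \<phi> z) = (LINT z|disk_measure. f z * \<phi> z))"
    (is "_ \<longleftrightarrow> ?m \<and> ?b \<and> ?o")
proof
  have fC: "f \<in> C" using f by (simp add: class_ball_def)
  note iff = Z_space_class[OF C fC, of g]
  {
    assume g: "g \<in> class_ball C k"
    then have "g \<in> C" by (simp add: class_ball_def)
    then have ?o using iff by simp
    then show "?m \<and> ?b \<and> ?o"
      using class_ball_measurable[OF C g] class_ball_AE[OF g] by simp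
  next
    assume g: "?m \<and> ?b \<and> ?o"
    then have "g \<in> Bel" by (intro BelI(1)[of g k]) simp_all
    then show "g \<in> class_ball C k" using g iff by (simp add: class_ball_def)
  }
qed

lemma class_ball_convex:
  assumes C: "C \<in> Z_space" and f: "f \<in> class_ball C k" and g: "g \<in> class_ball C k" and t: "0 \<le> t" "t \<le> 1"
  shows "(\<lambda>z. of_real (1 - t) * f z + of_real t * g z) \<in> class_ball C k"
  unfolding class_ball_iff[OF C f]
proof (intro conjI ballI)
  have [measurable]: "f \<in> borel_measurable disk_measure" "g \<in> borel_measurable disk_measure"
    using class_ball_measurable C f g by auto
  show "(\<lambda>z. of_real (1 - t) * f z + of_real t * g z) \<in> borel_measurable disk_measure"
    by measurable
  show "AE z in disk_measure. norm (of_real (1 - t) * f z + of_real t * g z) \<le> k"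
    using class_ball_AE[OF f] class_ball_AE[OF g]
  proof eventually_elim
    case (elim z)
    have "norm (of_real (1 - t) * f z + of_real t * g z) \<le> (1 - t) * norm (f z) + t * norm (g z)"
      using norm_triangle_ineq[of "of_real (1 - t) * f z" "of_real t * g z"] t
      by (simp add: norm_mult del: of_real_diff)
    also have "\<dots> \<le> (1 - t) * k + t * k"
      using elim t by (intro add_mono mult_left_mono) auto
    finally show ?case by (simp add: algebra_simps)
  qed
  fix \<phi> assume \<phi>: "\<phi> \<in> Q"
  have i: "integrable disk_measure (\<lambda>z. f z * \<phi> z)" "integrable disk_measure (\<lambda>z. g z * \<phi> z)"
    using integrable_Bel_mult_Q \<phi> class_ball_Bel C f g by auto
  have eq: "(LINT z|disk_measure. g z * \<phi> z) = (LINT z|disk_measure. f z * \<phi> z)"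
    using g \<phi> unfolding class_ball_iff[OF C f] by simp
  have "(LINT z|disk_measure. (of_real (1 - t) * f z + of_real t * g z) * \<phi> z) =
    (LINT z|disk_measure. of_real (1 - t) * (f z * \<phi> z) + of_real t * (g z * \<phi> z))"
    by (simp add: algebra_simps)
  also have "\<dots> = of_real (1 - t) * (LINT z|disk_measure. f z * \<phi> z) + of_real t * (LINT z|disk_measure. g z * \<phi> z)"
    using i by (subst Bochner_Integration.integral_add) (auto simp del: of_real_diff)
  also have "\<dots> = (LINT z|disk_measure. f z * \<phi> z)"
    unfolding eq by (simp add: ring_distribs)
  finally show "(LINT z|disk_measure. (of_real (1 - t) * f z + of_real t * g z) * \<phi> z) =
    (LINT z|disk_measure. f z * \<phi> z)" .
qed

section \<open>The pseudometric and its completeness\<close>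

lemma class_ball_integrable_dist:
  assumes C: "C \<in> Z_space" and f: "f \<in> class_ball C k" and g: "g \<in> class_ball C k"
  shows "integrable disk_measure (\<lambda>z. norm (f z - g z))"
proof -
  have [measurable]: "f \<in> borel_measurable disk_measure" "g \<in> borel_measurable disk_measure"
    using class_ball_measurable C f g by auto
  show ?thesis
  proof (rule integrable_disk_bounded[where B = "2 * k"])
    show "AE z in disk_measure. norm (norm (f z - g z)) \<le> 2 * k"
      using class_ball_AE[OF f] class_ball_AE[OF g]
    proof eventually_elim
      case (elim z)
      then show ?case using norm_triangle_ineq4[of "f z" "g z"] by simp
    qed
  qed measurable
qed

lemma l1_dist_nonneg: "0 \<le> l1_dist f g"
  by (simp add: l1_dist_def)

lemma l1_dist_commute: "l1_dist f g = l1_dist g f"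
  by (simp add: l1_dist_def norm_minus_commute)

lemma l1_dist_triangle:
  assumes C: "C \<in> Z_space" and f: "f \<in> class_ball C k" and g: "g \<in> class_ball C k" and h: "h \<in> class_ball C k"
  shows "l1_dist f h \<le> l1_dist f g + l1_dist g h"
proof -
  note i = class_ball_integrable_dist[OF C]
  have "l1_dist f h \<le> (LINT z|disk_measure. norm (f z - g z) + norm (g z - h z))"
    unfolding l1_dist_def using i[OF f g] i[OF g h] i[OF f h] norm_triangle_ineq[of "f z - g z" "g z - h z" for z]
    by (intro integral_mono) auto
  also have "\<dots> = l1_dist f g + l1_dist g h"
    unfolding l1_dist_def by (rule Bochner_Integration.integral_add[OF i[OF f g] i[OF g h]])
  finally show ?thesis .
qed

lemma l1_dist_eq_0_iff:
  assumes C: "C \<in> Z_space" and f: "f \<in> class_ball C k" and g: "g \<in> class_ball C k"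
  shows "l1_dist f g = 0 \<longleftrightarrow> (f, g) \<in> bel_rel"
  unfolding l1_dist_def using class_ball_integrable_dist[OF assms] class_ball_Bel[OF C] f g
  by (subst integral_nonneg_eq_0_iff_AE) (auto simp: bel_rel_def)

text \<open>As in the Riesz-Fischer theorem, summable steps make the series of pointwise differences
  a.e. absolutely convergent. The bound \<open>k\<close> survives the pointwise limit, and dominated
  convergence carries over both the pairings with \<open>Q\<close> and the \<open>L1\<close>
  distances.\<close>

lemma class_ball_complete:
  assumes C: "C \<in> Z_space" and f: "\<And>n. f n \<in> class_ball C k"
    and cauchy: "\<And>n. l1_dist (f n) (f (Suc n)) \<le> (1 / 2) ^ n"
  obtains g where "g \<in> class_ball C k" "(\<lambda>n. l1_dist (f n) g) \<longlonglongrightarrow> 0"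
proof -
  have [measurable]: "f n \<in> borel_measurable disk_measure" for n
    using class_ball_measurable C f by auto
  have "(\<integral>\<^sup>+ z. (\<Sum>n. ennreal (norm (f n z - f (Suc n) z))) \<partial>disk_measure) =
    (\<Sum>n. \<integral>\<^sup>+ z. ennreal (norm (f n z - f (Suc n) z)) \<partial>disk_measure)"
    by (rule nn_integral_suminf) measurable
  also have "\<dots> = (\<Sum>n. ennreal (l1_dist (f n) (f (Suc n))))"
    unfolding l1_dist_def
    by (intro suminf_cong nn_integral_eq_integral class_ball_integrable_dist[OF C f f]) auto
  also have "\<dots> \<le> (\<Sum>n. ennreal ((1 / 2) ^ n))"
    by (intro suminf_le ennreal_leI cauchy) auto
  also have "\<dots> = ennreal (\<Sum>n. (1 / 2) ^ n)"
    by (intro suminf_ennreal2) (auto simp: summable_geometric)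
  also have "\<dots> < \<infinity>" by simp
  finally have "AE z in disk_measure. (\<Sum>n. ennreal (norm (f n z - f (Suc n) z))) \<noteq> \<infinity>"
    by (intro nn_integral_PInf_AE) auto
  then have conv: "AE z in disk_measure. convergent (\<lambda>n. f n z)"
  proof eventually_elim
    case (elim z)
    then have "summable (\<lambda>n. norm (f n z - f (Suc n) z))"
      by (intro summable_suminf_not_top) auto
    then have "summable (\<lambda>n. f (Suc n) z - f n z)"
      by (subst (asm) norm_minus_commute) (rule summable_norm_cancel)
    then have "convergent (\<lambda>n. f n z - f 0 z)"
      by (simp add: summable_iff_convergent sum_lessThan_telescope[of "\<lambda>n. f n z"])
    then have "convergent (\<lambda>n. (f n z - f 0 z) + f 0 z)"
      by (intro convergent_add convergent_const)
    then show ?case by simp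
  qed
  \<comment> \<open>Where the sequence diverges, \<open>lim\<close> is an unspecified default value;
    this concerns only a null set.\<close>
  define g where "g z = lim (\<lambda>n. f n z)" for z
  have [measurable]: "g \<in> borel_measurable disk_measure"
    unfolding g_def by measurable
  have tends: "AE z in disk_measure. (\<lambda>n. f n z) \<longlonglongrightarrow> g z"
    using conv by eventually_elim (simp add: g_def convergent_LIMSEQ_iff)
  have fb: "AE z in disk_measure. \<forall>n. norm (f n z) \<le> k"
    using class_ball_AE[OF f] by (simp add: AE_all_countable)
  have gb: "AE z in disk_measure. norm (g z) \<le> k"
    using tends fb
  proof eventually_elim
    case (elim z)
    then show ?case by (intro tendsto_upperbound[OF tendsto_norm]) auto
  qed
  have g: "g \<in> class_ball C k"
    unfolding class_ball_iff[OF C f[of 0]]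
  proof (intro conjI ballI gb)
    fix \<phi> assume \<phi>: "\<phi> \<in> Q"
    then have \<phi>i: "integrable disk_measure \<phi>" by (simp add: Q_def)
    then have [measurable]: "\<phi> \<in> borel_measurable disk_measure" by simp
    have "(\<lambda>n. LINT z|disk_measure. f n z * \<phi> z) \<longlonglongrightarrow> (LINT z|disk_measure. g z * \<phi> z)"
    proof (rule integral_dominated_convergence[where w = "\<lambda>z. k * norm (\<phi> z)"])
      show "AE z in disk_measure. (\<lambda>n. f n z * \<phi> z) \<longlonglongrightarrow> g z * \<phi> z"
        using tends by eventually_elim (intro tendsto_intros)
      show "AE z in disk_measure. norm (f n z * \<phi> z) \<le> k * norm (\<phi> z)" for n
        using class_ball_AE[OF f[of n]] by eventually_elim (auto simp: norm_mult intro: mult_right_mono)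
    qed (use \<phi>i in auto)
    moreover have "(\<lambda>n. LINT z|disk_measure. f n z * \<phi> z) = (\<lambda>_. LINT z|disk_measure. f 0 z * \<phi> z)"
    proof
      show "(LINT z|disk_measure. f n z * \<phi> z) = (LINT z|disk_measure. f 0 z * \<phi> z)" for n
        using f[of n] \<phi> unfolding class_ball_iff[OF C f[of 0]] by simp
    qed
    ultimately show "(LINT z|disk_measure. g z * \<phi> z) = (LINT z|disk_measure. f 0 z * \<phi> z)"
      using LIMSEQ_unique[OF _ tendsto_const] by metis
  qed measurable
  have "(\<lambda>n. l1_dist (f n) g) \<longlonglongrightarrow> (LINT z|disk_measure. 0)"
    unfolding l1_dist_def
  proof (rule integral_dominated_convergence[where w = "\<lambda>_. 2 * k"])
    show "integrable disk_measure (\<lambda>_. 2 * k)"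
      by (rule finite_measure.integrable_const[OF finite_measure_disk])
    show "AE z in disk_measure. (\<lambda>n. norm (f n z - g z)) \<longlonglongrightarrow> 0"
      using tends by eventually_elim (simp add: LIM_zero tendsto_norm_zero)
    show "AE z in disk_measure. norm (norm (f n z - g z)) \<le> 2 * k" for n
      using fb gb
    proof eventually_elim
      case (elim z)
      then have "norm (f n z) \<le> k" by blast
      then show ?case using elim(2) norm_triangle_ineq4[of "f n z" "g z"] by simp
    qed
  qed measurable
  then show thesis using that[OF g] by simp
qed

section \<open>Baire category\<close>

text \<open>The assumption on \<open>T\<close> says that each \<open>T n\<close> is nowhere dense.
  Nested closed balls with shrinking radii avoid the \<open>T n\<close> one after another, and by
  completeness the centres converge to a point lying in all balls.\<close>

lemma class_ball_Baire:
  fixes T :: "nat \<Rightarrow> (complex \<Rightarrow> complex) set"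
  assumes C: "C \<in> Z_space"
    and T: "\<And>n h \<epsilon>. h \<in> class_ball C k \<Longrightarrow> 0 < \<epsilon> \<Longrightarrow> \<exists>h'\<in>class_ball C k. l1_dist h h' < \<epsilon> \<and>
      (\<exists>\<rho>>0. \<forall>g\<in>class_ball C k. l1_dist h' g < \<rho> \<longrightarrow> g \<notin> T n)"
    and f: "f \<in> class_ball C k" and \<epsilon>: "0 < \<epsilon>"
  obtains g where "g \<in> class_ball C k" "l1_dist f g < \<epsilon>" "\<And>n. g \<notin> T n"
proof -
  let ?E = "class_ball C k"
  \<comment> \<open>A state is a pair of centre and radius. The bound on the radius gives the Cauchy
    rate demanded by completeness; the clause for index 0 anchors the first ball at \<open>f\<close>
    inside distance \<open>\<epsilon>\<close>.\<close>
  define P where "P n x \<longleftrightarrow> fst x \<in> ?E \<and> 0 < snd x \<and> snd x \<le> (1 / 2) ^ n \<and>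
    (n = 0 \<longrightarrow> fst x = f \<and> snd x < \<epsilon>)" for n :: nat and x :: "(complex \<Rightarrow> complex) \<times> real"
  \<comment> \<open>The inequality forces the next closed ball into the current one. The index is
    shifted: the ball with index \<open>Suc n\<close> is the one that avoids
    \<open>T n\<close>.\<close>
  define S where "S n x y \<longleftrightarrow> l1_dist (fst x) (fst y) + snd y \<le> snd x \<and>
    (\<forall>g\<in>?E. l1_dist (fst y) g \<le> snd y \<longrightarrow> g \<notin> T n)" for n :: nat and x y :: "(complex \<Rightarrow> complex) \<times> real"
  have "\<exists>x. \<forall>n. P n (x n) \<and> S n (x n) (x (Suc n))"
  proof (rule dependent_nat_choice)
    have "P 0 (f, min 1 (\<epsilon> / 2))" using f \<epsilon> by (auto simp: P_def)
    then show "\<exists>x. P 0 x" ..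
  next
    fix x n assume "P n x"
    then have x: "fst x \<in> ?E" "0 < snd x" "snd x \<le> (1 / 2) ^ n" by (auto simp: P_def)
    obtain h' \<rho> where h': "h' \<in> ?E" "l1_dist (fst x) h' < snd x / 2" "\<rho> > 0"
      "\<And>g. g \<in> ?E \<Longrightarrow> l1_dist h' g < \<rho> \<Longrightarrow> g \<notin> T n"
      using T[OF x(1), of "snd x / 2" n] x(2) by auto
    \<comment> \<open>Halving \<open>\<rho>\<close> puts the closed ball inside the open ball that
      misses \<open>T n\<close>; halving the old radius leaves room for the move of the
      centre.\<close>
    have "P (Suc n) (h', min (\<rho> / 2) (snd x / 2))" "S n x (h', min (\<rho> / 2) (snd x / 2))"
      using x h' by (auto simp: P_def S_def min_le_iff_disj)
    then show "\<exists>y. P (Suc n) y \<and> S n x y" by blast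
  qed
  then obtain x where x: "\<And>n. P n (x n)" "\<And>n. S n (x n) (x (Suc n))" by blast
  define h \<rho> where "h n = fst (x n)" and "\<rho> n = snd (x n)" for n
  have h: "h n \<in> ?E" "0 < \<rho> n" "\<rho> n \<le> (1 / 2) ^ n" for n
    using x(1)[of n] by (auto simp: P_def h_def \<rho>_def)
  have h0: "h 0 = f" "\<rho> 0 < \<epsilon>"
    using x(1)[of 0] by (auto simp: P_def h_def \<rho>_def)
  have step: "l1_dist (h n) (h (Suc n)) + \<rho> (Suc n) \<le> \<rho> n"
    and T': "g \<in> ?E \<Longrightarrow> l1_dist (h (Suc n)) g \<le> \<rho> (Suc n) \<Longrightarrow> g \<notin> T n" for n g
    using x(2)[of n] by (auto simp: S_def h_def \<rho>_def)
  have "l1_dist (h n) (h (Suc n)) \<le> (1 / 2) ^ n" for n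
    using step[of n] h(2)[of "Suc n"] h(3)[of n] by linarith
  then obtain g where g: "g \<in> ?E" "(\<lambda>n. l1_dist (h n) g) \<longlonglongrightarrow> 0"
    using class_ball_complete[of C h k] C h(1) by blast
  \<comment> \<open>Keeping the later radius on the left lets the nesting inequalities
    telescope.\<close>
  have chain: "l1_dist (h n) (h (n + m)) + \<rho> (n + m) \<le> \<rho> n" for n m
  proof (induction m)
    case 0
    then show ?case by (simp add: l1_dist_def)
  next
    case (Suc m)
    then show ?case
      using step[of "n + m"] l1_dist_triangle[OF C h(1)[of n] h(1)[of "n + m"] h(1)[of "Suc (n + m)"]]
      by simp
  qed
  have lim: "l1_dist (h n) g \<le> \<rho> n" for n
  proof -
    have "l1_dist (h n) g \<le> \<rho> n + l1_dist (h (m + n)) g" for m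
      using chain[of n m] h(2)[of "n + m"] l1_dist_triangle[OF C h(1)[of n] h(1)[of "n + m"] g(1)]
      by (simp add: add.commute)
    moreover have "(\<lambda>m. \<rho> n + l1_dist (h (m + n)) g) \<longlonglongrightarrow> \<rho> n + 0"
      by (intro tendsto_intros LIMSEQ_ignore_initial_segment g)
    ultimately show ?thesis
      using LIMSEQ_le_const[of _ "\<rho> n"] by auto
  qed
  show thesis
    using that[OF g(1)] lim[of 0] h0 T'[OF g(1) lim] by auto
qed

section \<open>Density of weakly non-decreasable extremals\<close>

text \<open>Moving \<open>f\<close> by a fraction \<open>t\<close> towards \<open>h\<close> creates
  room \<open>t * \<delta>\<close> below \<open>k\<close> on \<open>U\<close>. That room absorbs
  \<open>\<zeta>\<close>, which compensates for erasing the function on a small disk. The result is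
  at most \<open>\<eta> / 2\<close> on a disk of positive area \<open>v\<close>, hence at distance
  at least \<open>v * (\<eta> / 2)\<close> from anything bounded below by \<open>\<eta>\<close> on
  \<open>U\<close>.\<close>

lemma class_ball_far_from_bounded_below:
  assumes C: "C \<in> Z_space" and f: "f \<in> class_ball C k" and \<epsilon>: "0 < \<epsilon>"
    and U: "open U" "U \<noteq> {}" "U \<subseteq> \<Delta>"
    and h: "h \<in> class_ball C k" and \<delta>: "0 < \<delta>" and hU: "AE z in disk_measure. z \<in> U \<longrightarrow> norm (h z) \<le> k - \<delta>"
    and \<eta>: "0 < \<eta>"
  obtains f' \<rho> where "f' \<in> class_ball C k" "l1_dist f f' < \<epsilon>" "0 < \<rho>"
    "\<forall>g\<in>class_ball C k. l1_dist f' g < \<rho> \<longrightarrow> \<not> (AE z in disk_measure. z \<in> U \<longrightarrow> \<eta> \<le> norm (g z))"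
proof -
  define A where "A = measure disk_measure \<Delta>"
  have A: "0 \<le> A" by (simp add: A_def)
  have sp: "space disk_measure = \<Delta>" by (simp add: space_restrict_space)
  note ci = finite_measure.integrable_const[OF finite_measure_disk]
  \<comment> \<open>One positive constant that dominates both \<open>2 * \<bar>k\<bar> * A\<close>,
    for the move towards \<open>h\<close>, and \<open>\<bar>k\<bar> + A\<close>, for the surgery on
    the small disk.\<close>
  define D where "D = (2 * \<bar>k\<bar> + 1) * (A + 1)"
  have D: "D > 0" using A by (auto simp: D_def intro!: mult_pos_pos)
  define t where "t = min 1 (\<epsilon> / (2 * D))"
  have t: "0 < t" "t \<le> 1" "t * D \<le> \<epsilon> / 2"
    using D \<epsilon> by (auto simp: t_def min_def field_simps)
  define f1 where "f1 z = of_real (1 - t) * f z + of_real t * h z" for z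
  have f1: "f1 \<in> class_ball C k"
    unfolding f1_def using t by (intro class_ball_convex C f h) auto
  have f1m: "f1 \<in> borel_measurable disk_measure" by (rule class_ball_measurable[OF C f1])
  have f1U: "AE z in disk_measure. z \<in> U \<longrightarrow> norm (f1 z) \<le> k - t * \<delta>"
    using class_ball_AE[OF f] hU
  proof eventually_elim
    case (elim z)
    show ?case
    proof
      assume "z \<in> U"
      have "norm (f1 z) \<le> (1 - t) * norm (f z) + t * norm (h z)"
        unfolding f1_def using norm_triangle_ineq[of "of_real (1 - t) * f z" "of_real t * h z"] t
        by (simp add: norm_mult del: of_real_diff)
      also have "\<dots> \<le> (1 - t) * k + t * (k - \<delta>)"
        using elim t \<open>z \<in> U\<close> by (intro add_mono mult_left_mono) auto
      finally show "norm (f1 z) \<le> k - t * \<delta>" by (simp add: algebra_simps)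
    qed
  qed
  have d1: "l1_dist f f1 \<le> \<epsilon> / 2"
  proof -
    have "l1_dist f f1 \<le> (LINT z|disk_measure. t * (2 * \<bar>k\<bar>))"
      unfolding l1_dist_def
    proof (intro integral_mono_AE class_ball_integrable_dist[OF C f f1] ci)
      show "AE z in disk_measure. norm (f z - f1 z) \<le> t * (2 * \<bar>k\<bar>)"
        using class_ball_AE[OF f] class_ball_AE[OF h]
      proof eventually_elim
        case (elim z)
        have "f z - f1 z = of_real t * (f z - h z)" by (simp add: f1_def algebra_simps)
        then have "norm (f z - f1 z) = t * norm (f z - h z)" using t by (simp add: norm_mult)
        also have "\<dots> \<le> t * (2 * \<bar>k\<bar>)"
          using elim t norm_triangle_ineq4[of "f z" "h z"] by (intro mult_left_mono) auto
        finally show ?case .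
      qed
    qed
    also have "\<dots> = t * (2 * \<bar>k\<bar> * A)" by (simp add: A_def sp)
    also have "\<dots> \<le> t * D"
      using t A by (intro mult_left_mono) (auto simp: D_def algebra_simps)
    finally show ?thesis using t by simp
  qed
  obtain p where p: "p \<in> U" using U(2) by blast
  obtain R where pR: "R > 0" "cball p R \<subseteq> U"
    using U(1) p unfolding open_contains_cball by blast
  have sub: "cball p R \<subseteq> \<Delta>" using pR U by auto
  \<comment> \<open>The three bounds keep \<open>f2\<close> below \<open>k\<close> on the large
    disk, make it at most \<open>\<eta> / 2\<close> on the small one, and limit the second
    displacement to less than \<open>\<epsilon> / 2\<close>.\<close>
  define e where "e = Min {t * \<delta>, \<eta> / 2, \<epsilon> / (4 * D)}"
  have e: "0 < e" "e \<le> t * \<delta>" "e \<le> \<eta> / 2" "e \<le> \<epsilon> / (4 * D)"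
    using t \<delta> \<eta> \<epsilon> D by (auto simp: e_def)
  obtain r \<zeta> where r: "0 < r" "r < R" "measure disk_measure (ball p r) \<le> e"
    and \<zeta>m: "\<zeta> \<in> borel_measurable disk_measure"
    and \<zeta>': "\<forall>z. norm (\<zeta> z) \<le> e" "\<forall>z. z \<notin> ball p R \<longrightarrow> \<zeta> z = 0"
    and \<zeta>i: "\<forall>\<phi>\<in>Q. (LINT z|disk_measure. indicator (ball p r) z * (f1 z * \<phi> z)) =
      (LINT z|disk_measure. \<zeta> z * \<phi> z)"
    using sup_small_representative_on_ball[OF sub pR(1) f1m class_ball_AE[OF f1] e(1)] .
  have \<zeta>: "norm (\<zeta> z) \<le> e" "z \<notin> ball p R \<Longrightarrow> \<zeta> z = 0" for z
    using \<zeta>' by simp_all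
  have brsets: "ball p r \<in> sets disk_measure"
    using sub r by (auto simp: sets_restrict_space_iff subset_eq)
  have brint: "ball p r \<inter> \<Delta> = ball p r"
    using sub r by (auto simp: subset_eq)
  define v where "v = measure disk_measure (ball p r)"
  have v: "0 < v"
  proof -
    have "v = measure lebesgue (ball p r)"
      unfolding v_def using brint by (intro measure_restrict_space) auto
    then show ?thesis using r content_ball_pos[of r p] by simp
  qed
  have iv: "integrable disk_measure (\<lambda>z. indicator (ball p r) z * c)"
    and iv': "(LINT z|disk_measure. indicator (ball p r) z * c) = v * c" for c :: real
    using brsets by (simp_all add: v_def brint sp finite_measure.emeasure_eq_measure[OF finite_measure_disk])
  define f2 where "f2 z = f1 z - indicator (ball p r) z * f1 z + \<zeta> z" for z
  have f2m: "f2 \<in> borel_measurable disk_measure"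
    unfolding f2_def
    by (intro borel_measurable_add borel_measurable_diff borel_measurable_times f1m \<zeta>m indicator_disk_measurable)
  have f2: "f2 \<in> class_ball C k"
    unfolding class_ball_iff[OF C f1]
  proof (intro conjI ballI f2m)
    show "AE z in disk_measure. norm (f2 z) \<le> k"
      using f1U class_ball_AE[OF f1]
    proof eventually_elim
      case (elim z)
      show ?case
      proof (cases "z \<in> ball p R")
        case True
        then have "z \<in> U" using pR(2) ball_subset_cball[of p R] by blast
        then have "norm (f1 z) \<le> k - t * \<delta>" using elim by blast
        moreover have "norm (f1 z - indicator (ball p r) z * f1 z) \<le> norm (f1 z)"
          by (simp add: indicator_def)
        ultimately show ?thesis
          using norm_triangle_ineq[of "f1 z - indicator (ball p r) z * f1 z" "\<zeta> z"] \<zeta>(1)[of z] e(2)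
          unfolding f2_def by linarith
      next
        case False
        then have "z \<notin> ball p r" using r by auto
        then show ?thesis using False elim \<zeta>(2)[of z] by (simp add: f2_def)
      qed
    qed
    fix \<phi> assume \<phi>: "\<phi> \<in> Q"
    have i1: "integrable disk_measure (\<lambda>z. f1 z * \<phi> z)"
      by (rule integrable_Bel_mult_Q[OF class_ball_Bel[OF C f1] \<phi>])
    have i2: "integrable disk_measure (\<lambda>z. \<zeta> z * \<phi> z)"
      using \<zeta>m \<zeta>(1) by (intro integrable_Bel_mult_Q[OF _ \<phi>] BelI(1)[where k = e]) auto
    have i3: "integrable disk_measure (\<lambda>z. indicator (ball p r) z * (f1 z * \<phi> z))"
    proof -
      have "indicator (ball p r) z *\<^sub>R (f1 z * \<phi> z) = indicator (ball p r) z * (f1 z * \<phi> z)" for z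
        by (simp add: indicator_def)
      then show ?thesis using integrable_mult_indicator[OF brsets i1] by (simp only:)
    qed
    have "(LINT z|disk_measure. f2 z * \<phi> z) =
      (LINT z|disk_measure. f1 z * \<phi> z - indicator (ball p r) z * (f1 z * \<phi> z) + \<zeta> z * \<phi> z)"
      by (simp add: f2_def algebra_simps)
    also have "\<dots> = (LINT z|disk_measure. f1 z * \<phi> z)"
      using i1 i2 i3 by (simp add: bspec[OF \<zeta>i \<phi>])
    finally show "(LINT z|disk_measure. f2 z * \<phi> z) = (LINT z|disk_measure. f1 z * \<phi> z)" .
  qed
  have d2: "l1_dist f1 f2 < \<epsilon> / 2"
  proof -
    have "l1_dist f1 f2 \<le> (LINT z|disk_measure. indicator (ball p r) z * \<bar>k\<bar> + e)"
      unfolding l1_dist_def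
    proof (intro integral_mono_AE class_ball_integrable_dist[OF C f1 f2] Bochner_Integration.integrable_add ci iv)
      show "AE z in disk_measure. norm (f1 z - f2 z) \<le> indicator (ball p r) z * \<bar>k\<bar> + e"
        using class_ball_AE[OF f1]
      proof eventually_elim
        case (elim z)
        have "f1 z - f2 z = indicator (ball p r) z * f1 z - \<zeta> z" by (simp add: f2_def)
        then have "norm (f1 z - f2 z) \<le> norm (indicator (ball p r) z * f1 z) + norm (\<zeta> z)"
          by (simp only: norm_triangle_ineq4)
        then show ?case
          using elim \<zeta>(1)[of z] by (auto simp: indicator_def split: if_splits)
      qed
    qed
    also have "\<dots> = v * \<bar>k\<bar> + A * e"
      using iv[of "\<bar>k\<bar>"] ci[of e] by (subst Bochner_Integration.integral_add) (simp_all add: v_def brint A_def sp)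
    also have "\<dots> \<le> e * \<bar>k\<bar> + A * e"
      using r by (auto simp: v_def intro!: mult_right_mono)
    also have "\<dots> = e * (\<bar>k\<bar> + A)" by (simp add: algebra_simps)
    also have "\<dots> \<le> \<epsilon> / (4 * D) * D"
      using e A D \<epsilon> by (intro mult_mono) (auto simp: D_def algebra_simps)
    also have "\<dots> < \<epsilon> / 2" using D \<epsilon> by simp
    finally show ?thesis .
  qed
  have far: "\<not> (AE z in disk_measure. z \<in> U \<longrightarrow> \<eta> \<le> norm (g z))"
    if g: "g \<in> class_ball C k" and d: "l1_dist f2 g < v * (\<eta> / 2)" for g
  proof
    assume ge: "AE z in disk_measure. z \<in> U \<longrightarrow> \<eta> \<le> norm (g z)"
    have "v * (\<eta> / 2) = (LINT z|disk_measure. indicator (ball p r) z * (\<eta> / 2))"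
      by (simp only: iv')
    also have "\<dots> \<le> l1_dist f2 g"
      unfolding l1_dist_def
    proof (intro integral_mono_AE class_ball_integrable_dist[OF C f2 g] iv)
      show "AE z in disk_measure. indicator (ball p r) z * (\<eta> / 2) \<le> norm (f2 z - g z)"
        using ge
      proof eventually_elim
        case (elim z)
        show ?case
        proof (cases "z \<in> ball p r")
          case True
          then have "z \<in> U" using r pR(2) by (auto simp: subset_eq)
          then have "\<eta> \<le> norm (g z)" using elim by blast
          moreover have "norm (f2 z) \<le> \<eta> / 2"
            using True \<zeta>(1)[of z] e by (simp add: f2_def)
          ultimately show ?thesis
            using norm_triangle_ineq2[of "g z" "f2 z"] True by (simp add: norm_minus_commute)
        qed simp
      qed
    qed
    finally show False using d by simp
  qed
  show thesis
  proof (rule that[OF f2])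
    show "l1_dist f f2 < \<epsilon>"
      using l1_dist_triangle[OF C f f1 f2] d1 d2 by linarith
    show "0 < v * (\<eta> / 2)" using v \<eta> by simp
    show "\<forall>g\<in>class_ball C k. l1_dist f2 g < v * (\<eta> / 2) \<longrightarrow> \<not> (AE z in disk_measure. z \<in> U \<longrightarrow> \<eta> \<le> norm (g z))"
      using far by blast
  qed
qed

text \<open>Shrinking the domain to a basic open set and the drop to some
  \<open>1 / real (Suc n)\<close> leaves countably many ways of being strongly decreasable. Each
  confines \<open>g\<close> to a nowhere dense set, so Baire's argument applies.\<close>

lemma dense_not_strongly_decreasable:
  assumes C: "C \<in> Z_space" and f: "f \<in> class_ball C k" and \<epsilon>: "0 < \<epsilon>"
  obtains g where "g \<in> class_ball C k" "l1_dist f g < \<epsilon>" "\<not> strongly_decreasable_in C g"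
proof -
  have "\<exists>B :: nat \<Rightarrow> complex set. (\<forall>n. open (B n)) \<and> (\<forall>S. open S \<longrightarrow> (\<exists>N. S = \<Union>{B n |n. n \<in> N}))"
    by (rule univ_second_countable_sequence[where 'a = complex]) blast
  then obtain B :: "nat \<Rightarrow> complex set" where B': "\<forall>n. open (B n)"
    "\<forall>S. open S \<longrightarrow> (\<exists>N. S = \<Union>{B n |n. n \<in> N})"
    by (elim exE conjE)
  note B = B'[rule_format]
  define lo where "lo \<eta> U g \<longleftrightarrow> (AE z in disk_measure. z \<in> U \<longrightarrow> \<eta> \<le> norm (g z))"
    for \<eta> U and g :: "complex \<Rightarrow> complex"
  \<comment> \<open>This condition does not involve \<open>g\<close>: when it fails for a pair, the
    corresponding \<open>T i\<close> is empty; when it holds, the witness \<open>h\<close> is what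
    the perturbation moves towards.\<close>
  define hi where "hi \<eta> U \<longleftrightarrow> U \<noteq> {} \<and> U \<subseteq> \<Delta> \<and>
    (\<exists>h\<in>class_ball C k. AE z in disk_measure. z \<in> U \<longrightarrow> norm (h z) \<le> k - \<eta>)" for \<eta> U
  define T where "T i = (case prod_decode i of (j, n) \<Rightarrow>
    {g. hi (1 / real (Suc n)) (B j) \<and> lo (1 / real (Suc n)) (B j) g})" for i
  have nowhere_dense: "\<exists>h'\<in>class_ball C k. l1_dist h h' < \<epsilon>' \<and>
      (\<exists>\<rho>>0. \<forall>g\<in>class_ball C k. l1_dist h' g < \<rho> \<longrightarrow> g \<notin> T i)"
    if h: "h \<in> class_ball C k" and \<epsilon>': "0 < \<epsilon>'" for i h \<epsilon>'
  proof -
    obtain j n where jn: "prod_decode i = (j, n)" by fastforce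
    show ?thesis
    proof (cases "hi (1 / real (Suc n)) (B j)")
      case True
      then obtain h0 where U: "B j \<noteq> {}" "B j \<subseteq> \<Delta>" and h0: "h0 \<in> class_ball C k"
        "AE z in disk_measure. z \<in> B j \<longrightarrow> norm (h0 z) \<le> k - 1 / real (Suc n)"
        unfolding hi_def by blast
      have pos: "0 < 1 / real (Suc n)" by simp
      obtain f' \<rho> where f': "f' \<in> class_ball C k" "l1_dist h f' < \<epsilon>'" "0 < \<rho>"
        "\<forall>g\<in>class_ball C k. l1_dist f' g < \<rho> \<longrightarrow> \<not> lo (1 / real (Suc n)) (B j) g"
        unfolding lo_def
        by (rule class_ball_far_from_bounded_below[OF C h \<epsilon>' B(1) U h0(1) pos h0(2) pos])
      have "\<forall>g\<in>class_ball C k. l1_dist f' g < \<rho> \<longrightarrow> g \<notin> T i"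
        using f'(4) by (simp add: T_def jn)
      then show ?thesis using f'(1-3) by blast
    next
      case False
      then show ?thesis
        using h \<epsilon>' by (intro bexI[of _ h] conjI exI[of _ 1]) (auto simp: T_def jn l1_dist_def)
    qed
  qed
  have "\<exists>g\<in>class_ball C k. l1_dist f g < \<epsilon> \<and> (\<forall>i. g \<notin> T i)"
    by (rule class_ball_Baire[where T = T, OF C nowhere_dense f \<epsilon>]) (assumption, assumption, erule bexI[rotated], simp)
  then obtain g where g: "g \<in> class_ball C k" "l1_dist f g < \<epsilon>" "\<forall>i. g \<notin> T i"
    by blast
  have "\<not> strongly_decreasable_in C g"
  proof
    assume "strongly_decreasable_in C g"
    then obtain \<nu> G \<delta> where \<nu>: "\<nu> \<in> C" "AE z in disk_measure. norm (\<nu> z) \<le> norm (g z)"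
      and G: "open G" "G \<noteq> {}" "G \<subseteq> \<Delta>" and \<delta>: "\<delta> > 0"
      and drop: "AE z in lebesgue_on G. norm (\<nu> z) \<le> norm (g z) - \<delta>"
      unfolding strongly_decreasable_in_def by blast
    have "AE z in disk_measure. norm (\<nu> z) \<le> k"
      using \<nu>(2) class_ball_AE[OF g(1)] by eventually_elim simp
    \<comment> \<open>The decreased function itself obeys the bound \<open>k\<close>, so it serves
      as the witness in \<open>hi\<close>. Since its modulus is nonnegative, the drop also forces
      the lower bound in \<open>lo\<close> on \<open>g\<close>.\<close>
    then have \<nu>E: "\<nu> \<in> class_ball C k" using \<nu>(1) by (simp add: class_ball_def)
    obtain N where N: "G = \<Union>{B n |n. n \<in> N}" using B(2)[OF G(1)] by blast
    then obtain j where j: "B j \<noteq> {}" "B j \<subseteq> G" using G(2) by blast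
    obtain n where n: "1 / real (Suc n) < \<delta>"
      using reals_Archimedean[OF \<delta>] by (auto simp: inverse_eq_divide)
    have "AE z in lebesgue. z \<in> G \<longrightarrow> norm (\<nu> z) \<le> norm (g z) - \<delta>"
      using drop G(1) by (subst (asm) AE_restrict_space_iff) auto
    then have drop': "AE z in disk_measure. z \<in> B j \<longrightarrow> norm (\<nu> z) \<le> norm (g z) - \<delta>"
      using j by (subst AE_restrict_space_iff) (auto elim!: eventually_mono)
    have "AE z in disk_measure. z \<in> B j \<longrightarrow> norm (\<nu> z) \<le> k - 1 / real (Suc n)"
      using drop' class_ball_AE[OF g(1)] by eventually_elim (use n in auto)
    then have "hi (1 / real (Suc n)) (B j)"
      using j G(3) \<nu>E unfolding hi_def by blast
    moreover have "lo (1 / real (Suc n)) (B j) g"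
      unfolding lo_def using drop'
    proof eventually_elim
      case (elim z)
      show ?case
      proof
        assume "z \<in> B j"
        with elim have "norm (\<nu> z) \<le> norm (g z) - \<delta>" by blast
        then show "1 / real (Suc n) \<le> norm (g z)" using n norm_ge_zero[of "\<nu> z"] by linarith
      qed
    qed
    ultimately have "g \<in> T (prod_encode (j, n))" by (simp add: T_def)
    then show False using g(3) by blast
  qed
  then show thesis using that g by blast
qed

section \<open>Extremals as a ball, and infinitely many classes\<close>

lemma extremal_in_iff_class_ball:
  assumes C: "C \<in> Z_space" and "\<exists>\<mu>. extremal_in C \<mu>"
  obtains k where "\<And>f. extremal_in C f \<longleftrightarrow> f \<in> class_ball C k"
proof -
  from assms(2) obtain \<mu> where \<mu>: "\<mu> \<in> C" "linf_norm \<mu> = Z_norm C"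
    by (auto simp: extremal_in_def)
  have meas: "f \<in> borel_measurable disk_measure" if "f \<in> C" for f
    using iffD1[OF Z_space_class[OF C that] that] by (simp add: Bel_def)
  have "linf_norm \<mu> < \<infinity>"
    using iffD1[OF Z_space_class[OF C \<mu>(1)] \<mu>(1)] by (simp add: Bel_def)
  \<comment> \<open>In \<open>ereal\<close> an essential supremum of \<open>-\<infinity>\<close>
    would make the whole disk a null set, contradicting its positive area.\<close>
  moreover have "linf_norm \<mu> \<noteq> -\<infinity>"
  proof
    assume inf: "linf_norm \<mu> = -\<infinity>"
    have "AE z in disk_measure. ereal (norm (\<mu> z)) \<le> linf_norm \<mu>"
      unfolding linf_norm_def by (rule esssup_AE)
    then have "AE z in disk_measure. False" by (simp add: inf)
    then have "ae_filter disk_measure = bot"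
      by (simp add: trivial_limit_def)
    then have "emeasure disk_measure (space disk_measure) = 0"
      by (simp only: ae_filter_eq_bot_iff)
    then have "emeasure lebesgue \<Delta> = 0"
      by (simp add: space_restrict_space emeasure_restrict_space)
    then show False
      using content_ball_pos[of 1 "0::complex"] by (simp add: measure_def)
  qed
  ultimately obtain k where k: "Z_norm C = ereal k"
    using \<mu>(2) by (cases "Z_norm C") simp_all
  have "extremal_in C f \<longleftrightarrow> f \<in> class_ball C k" for f
  proof
    assume f: "extremal_in C f"
    have "AE z in disk_measure. ereal (norm (f z)) \<le> linf_norm f"
      unfolding linf_norm_def by (rule esssup_AE)
    then show "f \<in> class_ball C k"
      using f k by (simp add: extremal_in_def class_ball_def)
  next
    assume f: "f \<in> class_ball C k"
    then have fC: "f \<in> C" by (simp add: class_ball_def)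
    have "linf_norm f \<le> Z_norm C"
      unfolding k by (rule BelI(2)[OF meas[OF fC] class_ball_AE[OF f]])
    moreover have "Z_norm C \<le> linf_norm f"
      unfolding Z_norm_def by (rule INF_lower[OF fC])
    ultimately show "extremal_in C f" using fC by (simp add: extremal_in_def)
  qed
  then show thesis by (rule that)
qed

theorem theorem3:
  fixes C :: "(complex \<Rightarrow> complex) set"
  assumes "C \<in> Z_space"
    and "\<exists>\<mu> \<nu>. extremal_in C \<mu> \<and> extremal_in C \<nu> \<and> (\<mu>, \<nu>) \<notin> bel_rel"
  shows "infinite ({\<nu>. extremal_in C \<nu> \<and> weakly_non_decreasable_in C \<nu>} // bel_rel)"
proof
  let ?S = "{\<nu>. extremal_in C \<nu> \<and> weakly_non_decreasable_in C \<nu>}"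
  assume fin: "finite (?S // bel_rel)"
  note C = assms(1)
  from assms(2) obtain \<mu> \<nu> where mn: "extremal_in C \<mu>" "extremal_in C \<nu>" "(\<mu>, \<nu>) \<notin> bel_rel"
    by blast
  obtain k where k: "\<And>f. extremal_in C f \<longleftrightarrow> f \<in> class_ball C k"
    using extremal_in_iff_class_ball[OF C] mn(1) by blast
  have \<mu>: "\<mu> \<in> class_ball C k" and \<nu>: "\<nu> \<in> class_ball C k" using mn k by auto
  have S: "f \<in> ?S \<longleftrightarrow> f \<in> class_ball C k \<and> \<not> strongly_decreasable_in C f" for f
    by (auto simp: k weakly_non_decreasable_in_def class_ball_def)
  \<comment> \<open>One representative per class. Intersecting with \<open>?S\<close> keeps the
    choice among weakly non-decreasable extremals, with no appeal to invariance of that property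
    under a.e. equality.\<close>
  define F where "F = (\<lambda>X. SOME f. f \<in> X \<inter> ?S) ` (?S // bel_rel)"
  have finF: "finite F" unfolding F_def using fin by (rule finite_imageI)
  have F: "\<exists>f\<in>F. f \<in> ?S \<and> l1_dist g f = 0" if g: "g \<in> ?S" for g
  proof -
    have gE: "g \<in> class_ball C k" using g S by blast
    have "(g, g) \<in> bel_rel"
      using class_ball_Bel[OF C gE] by (simp add: bel_rel_def)
    then have "g \<in> bel_rel `` {g} \<inter> ?S" using g by blast
    then have s: "(SOME f. f \<in> bel_rel `` {g} \<inter> ?S) \<in> bel_rel `` {g} \<inter> ?S"
      by (rule someI[where P = "\<lambda>f. f \<in> bel_rel `` {g} \<inter> ?S"])
    have "(SOME f. f \<in> bel_rel `` {g} \<inter> ?S) \<in> F"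
      unfolding F_def using g by (intro imageI quotientI)
    moreover have "l1_dist g f = 0" if "f \<in> bel_rel `` {g} \<inter> ?S" for f
      using that S l1_dist_eq_0_iff[OF C gE] by blast
    ultimately show ?thesis using s by blast
  qed
  \<comment> \<open>An extremal at positive distance from each extremal in the finite set
    \<open>F\<close> would have a whole neighbourhood free of weakly non-decreasable ones, against
    density. The element 1 in \<open>?D\<close> keeps the minimum defined and positive.\<close>
  have near: "\<exists>f\<in>F \<inter> class_ball C k. l1_dist x f = 0" if x: "x \<in> class_ball C k" for x
  proof (rule ccontr)
    assume no: "\<not> ?thesis"
    let ?D = "insert 1 (l1_dist x ` (F \<inter> class_ball C k))"
    have fD: "finite ?D" using finF by simp
    have pos: "0 < Min ?D"
      using no l1_dist_nonneg[of x] fD by (subst Min_gr_iff) (auto simp: less_le)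
    obtain g where g: "g \<in> class_ball C k" "l1_dist x g < Min ?D" "\<not> strongly_decreasable_in C g"
      using dense_not_strongly_decreasable[OF C x pos] .
    then obtain f where f: "f \<in> F" "f \<in> ?S" "l1_dist g f = 0" using F[of g] S by blast
    have fE: "f \<in> class_ball C k" using f S by blast
    have "Min ?D \<le> l1_dist x f" using f fE fD by (intro Min_le) auto
    also have "\<dots> \<le> l1_dist x g + l1_dist g f" by (rule l1_dist_triangle[OF C x g(1) fE])
    finally show False using g f by simp
  qed
  \<comment> \<open>Along the segment from \<open>\<mu>\<close> to \<open>\<nu>\<close> distances
    are proportional to the parameter difference, so distinct parameters need distinct points of
    \<open>F\<close> at distance 0. An infinite interval then injects into \<open>F\<close>.\<close>
  define x where "x t z = of_real (1 - t) * \<mu> z + of_real t * \<nu> z" for t z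
  have x: "x t \<in> class_ball C k" if "t \<in> {0..1}" for t
    unfolding x_def using that by (intro class_ball_convex C \<mu> \<nu>) auto
  have dx: "l1_dist (x s) (x t) = \<bar>s - t\<bar> * l1_dist \<mu> \<nu>" for s t
  proof -
    have "x s z - x t z = of_real (t - s) * (\<mu> z - \<nu> z)" for z
      by (simp add: x_def algebra_simps)
    then have "norm (x s z - x t z) = \<bar>s - t\<bar> * norm (\<mu> z - \<nu> z)" for z
      by (simp add: norm_mult abs_minus_commute del: of_real_diff)
    then show ?thesis by (simp add: l1_dist_def)
  qed
  have "\<forall>t\<in>{0..1}. \<exists>f\<in>F \<inter> class_ball C k. l1_dist (x t) f = 0" using near x by blast
  then obtain q where q: "\<And>t. t \<in> {0..1} \<Longrightarrow> q t \<in> F \<inter> class_ball C k \<and> l1_dist (x t) (q t) = 0"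
    by metis
  have "inj_on q {0..1::real}"
  proof (rule inj_onI)
    fix s t :: real assume s: "s \<in> {0..1}" and t: "t \<in> {0..1}" and eq: "q s = q t"
    have "l1_dist (x s) (x t) \<le> l1_dist (x s) (q s) + l1_dist (q s) (x t)"
      using q[OF s] by (intro l1_dist_triangle[OF C x[OF s] _ x[OF t]]) auto
    also have "\<dots> = 0" using q[OF s] q[OF t] eq by (simp add: l1_dist_commute)
    finally have "\<bar>s - t\<bar> * l1_dist \<mu> \<nu> \<le> 0" by (simp add: dx)
    moreover have "0 < l1_dist \<mu> \<nu>"
      using l1_dist_eq_0_iff[OF C \<mu> \<nu>] mn(3) l1_dist_nonneg[of \<mu> \<nu>] by linarith
    ultimately show "s = t" by (simp add: mult_le_0_iff)
  qed
  moreover have "q ` {0..1} \<subseteq> F" using q by auto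
  ultimately have "finite {0..1::real}" using finF by (meson finite_imageD finite_subset)
  then show False by (simp add: infinite_Icc)
qed

end
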